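(* Let $X$ be a finite set of alternatives with $|X|=m\geq 3$ and $N=\{1,\dots,n\}$ with $n\geq 3$. If a social choice correspondence $G$ on $L(X)^N$ satisfies tops-only and balancedness, then $G$ is constant on the set of all non-unanimous profiles, i.e. on all profiles $u$ for which it is not the case that all individuals have the same top-ranked alternative.
   Context: An ordering on $X$ is a strict linear order (complete, asymmetric, transitive relation) on $X$; $L(X)$ is the set of all orderings; for an ordering $r$, $r[1]$ is its highest-ranked element. A profile is $u=(u(1),\dots,u(n))\in L(X)^N$. A social choice correspondence is a map $G$ from $L(X)^N$ to non-empty subsets of $X$. $G$ satisfies tops-only if for all profiles $u,v$ with $u(i)[1]=v(i)[1]$ for all $i$, $G(u)=G(v)$. Profile $v$ is constructed from $u$ by transposition pair $(x,y)$ via individuals $i$ and $j$ if at $u$, $x$ is immediately above $y$ in $u(i)$ and $y$ is immediately above $x$ in $u(j)$, and $v$ equals $u$ except that $x$ and $y$ are swapped in the orderings of $i$ and $j$. $G$ satisfies balancedness if $G(v)=G(u)$ whenever $v$ is constructed from $u$ by some transposition pair via some two individuals. *)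

theory Defs
  imports Main "HOL-Library.FuncSet" "HOL-Combinatorics.Transposition"
begin

text \<open>An ordering is a set of pairs, where \<open>(x, y) \<in> r\<close> means that \<open>x\<close> is ranked
  strictly above \<open>y\<close>.\<close>

definition orderings :: "'a set \<Rightarrow> 'a rel set" where
  "orderings X = {r. r \<subseteq> X \<times> X \<and> total_on X r \<and> asym r \<and> trans r}"

lemma orderings_iff_strict_linear_order_on:
  "r \<in> orderings X \<longleftrightarrow> r \<subseteq> X \<times> X \<and> strict_linear_order_on X r"
  unfolding orderings_def strict_linear_order_on_def
  by (auto simp: asym_on_iff_irrefl_on_if_trans_on)

definition top_ranked :: "'a set \<Rightarrow> 'a rel \<Rightarrow> 'a" where
  "top_ranked X r = (THE x. x \<in> X \<and> (\<forall>y\<in>X. y \<noteq> x \<longrightarrow> (x, y) \<in> r))"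

definition immediately_above :: "'a rel \<Rightarrow> 'a \<Rightarrow> 'a \<Rightarrow> bool" where
  "immediately_above r x y \<longleftrightarrow> (x, y) \<in> r \<and> \<not> (\<exists>z. (x, z) \<in> r \<and> (z, y) \<in> r)"

definition swap_in :: "'a \<Rightarrow> 'a \<Rightarrow> 'a rel \<Rightarrow> 'a rel" where
  "swap_in x y r = map_prod (transpose x y) (transpose x y) ` r"

text \<open>Profiles are undefined outside the set \<open>N\<close> of individuals, so that they are in
  bijection with tuples of orderings indexed by \<open>N\<close>.\<close>

definition profiles :: "'a set \<Rightarrow> 'i set \<Rightarrow> ('i \<Rightarrow> 'a rel) set" where
  "profiles X N = N \<rightarrow>\<^sub>E orderings X"

definition social_choice_correspondence ::
    "'a set \<Rightarrow> 'i set \<Rightarrow> (('i \<Rightarrow> 'a rel) \<Rightarrow> 'a set) \<Rightarrow> bool" where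
  "social_choice_correspondence X N G \<longleftrightarrow> (\<forall>u\<in>profiles X N. G u \<subseteq> X \<and> G u \<noteq> {})"

definition tops_only :: "'a set \<Rightarrow> 'i set \<Rightarrow> (('i \<Rightarrow> 'a rel) \<Rightarrow> 'a set) \<Rightarrow> bool" where
  "tops_only X N G \<longleftrightarrow>
    (\<forall>u\<in>profiles X N. \<forall>v\<in>profiles X N.
      (\<forall>i\<in>N. top_ranked X (u i) = top_ranked X (v i)) \<longrightarrow> G u = G v)"

text \<open>The two individuals are automatically distinct, since no ordering ranks \<open>x\<close> above
  \<open>y\<close> and \<open>y\<close> above \<open>x\<close>.\<close>

definition constructed_by_transposition_pair ::
    "('i \<Rightarrow> 'a rel) \<Rightarrow> 'a \<Rightarrow> 'a \<Rightarrow> 'i \<Rightarrow> 'i \<Rightarrow> ('i \<Rightarrow> 'a rel) \<Rightarrow> bool" where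
  "constructed_by_transposition_pair u x y i j v \<longleftrightarrow>
    immediately_above (u i) x y \<and> immediately_above (u j) y x \<and>
    v = u(i := swap_in x y (u i), j := swap_in x y (u j))"

definition balanced :: "'a set \<Rightarrow> 'i set \<Rightarrow> (('i \<Rightarrow> 'a rel) \<Rightarrow> 'a set) \<Rightarrow> bool" where
  "balanced X N G \<longleftrightarrow>
    (\<forall>u\<in>profiles X N. \<forall>v\<in>profiles X N. \<forall>x\<in>X. \<forall>y\<in>X. \<forall>i\<in>N. \<forall>j\<in>N.
      constructed_by_transposition_pair u x y i j v \<longrightarrow> G v = G u)"

definition unanimous :: "'a set \<Rightarrow> 'i set \<Rightarrow> ('i \<Rightarrow> 'a rel) \<Rightarrow> bool" where
  "unanimous X N u \<longleftrightarrow> (\<exists>x\<in>X. \<forall>i\<in>N. top_ranked X (u i) = x)"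

lemma top_ranked_unique:
  assumes "finite X" "X \<noteq> {}" "r \<in> orderings X"
  shows "\<exists>!x. x \<in> X \<and> (\<forall>y\<in>X. y \<noteq> x \<longrightarrow> (x, y) \<in> r)"
proof -
  have asym: "asym r" and trans: "trans r" and tot: "total_on X r"
    using assms(3) by (auto simp: orderings_def)
  have "acyclic r"
    using asym trans by (metis acyclic_irrefl asym_on_iff_irrefl_on_if_trans_on trancl_id)
  moreover have "finite r"
    using assms by (auto simp: orderings_def intro: finite_subset)
  ultimately have "wf r" by (simp add: finite_acyclic_wf)
  then obtain x where x: "x \<in> X" "\<And>y. (y, x) \<in> r \<Longrightarrow> y \<notin> X"
    using assms(2) by (meson wf_eq_minimal ex_in_conv)
  show ?thesis
  proof (rule ex1I[of _ x])
    show "x \<in> X \<and> (\<forall>y\<in>X. y \<noteq> x \<longrightarrow> (x, y) \<in> r)"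
      using x tot unfolding total_on_def by blast
  next
    fix z assume "z \<in> X \<and> (\<forall>y\<in>X. y \<noteq> z \<longrightarrow> (z, y) \<in> r)"
    then show "z = x" using x by metis
  qed
qed

lemma swap_in_orderings:
  assumes "r \<in> orderings X" "x \<in> X" "y \<in> X"
  shows "swap_in x y r \<in> orderings X"
proof -
  have mem: "(a, b) \<in> swap_in x y r \<longleftrightarrow> (transpose x y a, transpose x y b) \<in> r" for a b
    unfolding swap_in_def by (force simp: image_iff)
  have X: "transpose x y a \<in> X \<longleftrightarrow> a \<in> X" for a
    using assms(2,3) by (auto simp: transpose_def)
  have inj: "transpose x y a = transpose x y b \<longleftrightarrow> a = b" for a b
    by (metis transpose_involutory)
  have r: "r \<subseteq> X \<times> X" "total_on X r" "asym r" "trans r"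
    using assms(1) by (auto simp: orderings_def)
  have "swap_in x y r \<subseteq> X \<times> X"
    using r(1) unfolding swap_in_def by (auto simp: X dest: subsetD)
  moreover have "total_on X (swap_in x y r)"
    using r(2) by (auto simp: total_on_def mem X inj)
  moreover have "asym (swap_in x y r)"
    using r(3) by (auto intro!: asymI simp: mem dest: asymD)
  moreover have "trans (swap_in x y r)"
    using r(4) unfolding trans_def mem by blast
  ultimately show ?thesis by (simp add: orderings_def)
qed

lemma transposition_pair_profiles:
  assumes "u \<in> profiles X N" "x \<in> X" "y \<in> X" "i \<in> N" "j \<in> N"
    and "constructed_by_transposition_pair u x y i j v"
  shows "v \<in> profiles X N"
  using assms swap_in_orderings[of _ X x y]
  unfolding profiles_def constructed_by_transposition_pair_def
  by (auto simp: PiE_iff extensional_def)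

end

theory Submission
  imports Defs
begin

text \<open>
  By tops-only, only the vector of tops matters. Suppose individual \<open>i\<close> has top \<open>x\<close> and some
  individual \<open>j\<close> has top \<open>z \<notin> {x, y}\<close>. Choosing orderings that start \<open>x, y, z\<close> for \<open>i\<close> and
  \<open>z, y, x\<close> for \<open>j\<close>, a transposition pair \<open>(x, y)\<close> replaces the top of \<open>i\<close> by \<open>y\<close> and leaves the
  other tops unchanged. If no such \<open>j\<close> exists but the profile is non-unanimous before and after
  the change, then both \<open>x\<close> and \<open>y\<close> are tops of other individuals, and the change can be made in
  two steps through a third alternative. Hence every change of one ordering between non-unanimous
  profiles preserves the outcome. As there are at least three individuals, any two non-unanimous
  profiles are connected by such changes.
\<close>

lemma top_ranked_eqI:
  assumes "r \<in> orderings X" "x \<in> X" "\<And>y. y \<in> X \<Longrightarrow> y \<noteq> x \<Longrightarrow> (x, y) \<in> r"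
  shows "top_ranked X r = x"
  unfolding top_ranked_def
proof (rule the_equality)
  fix z assume z: "z \<in> X \<and> (\<forall>y\<in>X. y \<noteq> z \<longrightarrow> (z, y) \<in> r)"
  have "asym r" using assms(1) by (simp add: orderings_def)
  then show "z = x" using z assms(2,3) by (metis asymD)
qed (use assms in auto)

lemma
  assumes "finite X" "X \<noteq> {}" "r \<in> orderings X"
  shows top_ranked_in: "top_ranked X r \<in> X"
    and top_ranked_above: "y \<in> X \<Longrightarrow> y \<noteq> top_ranked X r \<Longrightarrow> (top_ranked X r, y) \<in> r"
  using theI'[OF top_ranked_unique[OF assms]] unfolding top_ranked_def by auto

lemma mem_swap_in: "(a, b) \<in> swap_in x y r \<longleftrightarrow> (transpose x y a, transpose x y b) \<in> r"
  unfolding swap_in_def by (force simp: image_iff)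

lemma top_ranked_swap_in:
  assumes "finite X" "r \<in> orderings X" "x \<in> X" "y \<in> X"
  shows "top_ranked X (swap_in x y r) = transpose x y (top_ranked X r)"
proof (rule top_ranked_eqI)
  have ne: "X \<noteq> {}" using assms by auto
  have X: "transpose x y a \<in> X \<longleftrightarrow> a \<in> X" for a
    using assms(3,4) by (auto simp: transpose_def)
  show "swap_in x y r \<in> orderings X" by (rule swap_in_orderings[OF assms(2-4)])
  show "transpose x y (top_ranked X r) \<in> X"
    using top_ranked_in[OF assms(1) ne assms(2)] X by simp
  fix b assume "b \<in> X" "b \<noteq> transpose x y (top_ranked X r)"
  then show "(transpose x y (top_ranked X r), b) \<in> swap_in x y r"
    using top_ranked_above[OF assms(1) ne assms(2), of "transpose x y b"] X
    by (metis mem_swap_in transpose_involutory)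
qed

lemma ordering_starting_with:
  assumes "finite X" "a \<in> X" "b \<in> X" "c \<in> X" "distinct [a, b, c]"
  obtains r where "r \<in> orderings X" "top_ranked X r = a"
    "immediately_above r a b" "immediately_above r b c"
proof -
  obtain e :: "'a \<Rightarrow> nat" where e: "inj_on e X"
    using finite_imp_inj_to_nat_seg[OF assms(1)] by blast
  \<comment> \<open>Smaller rank means higher in the ordering. The shift by 3 keeps the ranks 0, 1,
    2 free for \<open>a\<close>, \<open>b\<close>, \<open>c\<close>, so \<open>f\<close> is
    injective on \<open>X\<close>, and consecutive ranks leave no room for an alternative in
    between.\<close>
  define f where "f s = (if s = a then 0 else if s = b then 1 else if s = c then 2 else e s + 3)" for s
  define r where "r = {(s, t). s \<in> X \<and> t \<in> X \<and> f s < f t}"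
  have f: "f a = 0" "f b = 1" "f c = 2" using assms(5) by (auto simp: f_def)
  have inj: "s = t" if "s \<in> X" "t \<in> X" "f s = f t" for s t
    using that e by (auto simp: f_def inj_on_def split: if_splits)
  have r: "r \<in> orderings X"
    unfolding orderings_def
  proof (intro CollectI conjI)
    show "total_on X r" using inj by (force simp: total_on_def r_def)
  qed (auto simp: r_def trans_def intro!: asymI)
  moreover have "top_ranked X r = a"
  proof (rule top_ranked_eqI[OF r assms(2)])
    fix y assume "y \<in> X" "y \<noteq> a"
    then show "(a, y) \<in> r" using inj[of y a] f assms(2) by (auto simp: r_def)
  qed
  moreover have "immediately_above r a b" "immediately_above r b c"
    using assms f by (auto simp: immediately_above_def r_def)
  ultimately show thesis using that by blast
qed

lemma tops_onlyD:
  assumes "tops_only X N G" "u \<in> profiles X N" "v \<in> profiles X N"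
    and "\<And>i. i \<in> N \<Longrightarrow> top_ranked X (u i) = top_ranked X (v i)"
  shows "G u = G v"
  using assms unfolding tops_only_def by blast

lemma balancedD:
  assumes "balanced X N G" "u \<in> profiles X N" "v \<in> profiles X N"
    and "x \<in> X" "y \<in> X" "i \<in> N" "j \<in> N" "constructed_by_transposition_pair u x y i j v"
  shows "G v = G u"
  using assms unfolding balanced_def by blast

lemma profile_upd:
  assumes "u \<in> profiles X N" "i \<in> N" "r \<in> orderings X"
  shows "u(i := r) \<in> profiles X N"
  using assms unfolding profiles_def by (auto simp: PiE_iff extensional_def)

lemma change_ordering_with_witness:
  assumes fin: "finite X" and to: "tops_only X N G" and bal: "balanced X N G"
    and u: "u \<in> profiles X N" and i: "i \<in> N" and j: "j \<in> N" and r: "r \<in> orderings X"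
    and ne: "top_ranked X (u j) \<noteq> top_ranked X (u i)" "top_ranked X (u j) \<noteq> top_ranked X r"
    and X: "X \<noteq> {}"
  shows "G (u(i := r)) = G u"
proof -
  define x y z where "x = top_ranked X (u i)" and "y = top_ranked X r" and "z = top_ranked X (u j)"
  have uo: "u k \<in> orderings X" if "k \<in> N" for k
    using u that unfolding profiles_def by auto
  have mem: "x \<in> X" "y \<in> X" "z \<in> X"
    unfolding x_def y_def z_def using top_ranked_in[OF fin X] uo i j r by auto
  have v: "u(i := r) \<in> profiles X N" by (rule profile_upd[OF u i r])
  have ij: "i \<noteq> j" using ne by auto
  show ?thesis
  proof (cases "x = y")
    case True
    then show ?thesis by (intro tops_onlyD[OF to v u]) (auto simp: x_def y_def)
  next
    case False
    then have d: "distinct [x, y, z]" "distinct [z, y, x]"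
      using ne unfolding x_def y_def z_def by auto
    obtain p where p: "p \<in> orderings X" "top_ranked X p = x" "immediately_above p x y"
      by (rule ordering_starting_with[OF fin mem d(1)])
    obtain q where q: "q \<in> orderings X" "top_ranked X q = z" "immediately_above q y x"
      by (rule ordering_starting_with[OF fin mem(3,2,1) d(2)])
    \<comment> \<open>\<open>?u\<close> has the same tops as \<open>u\<close>, so tops-only
      identifies their outcomes, while the pair (\<open>x\<close>, \<open>y\<close>) can now be
      transposed via \<open>i\<close> and \<open>j\<close>.\<close>
    let ?u = "u(i := p, j := q)"
    let ?v = "?u(i := swap_in x y (?u i), j := swap_in x y (?u j))"
    have u': "?u \<in> profiles X N" by (intro profile_upd u i j p q)
    have c: "constructed_by_transposition_pair ?u x y i j ?v"
      unfolding constructed_by_transposition_pair_def using p q ij by simp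
    have v': "?v \<in> profiles X N"
      by (rule transposition_pair_profiles[OF u' mem(1,2) i j c])
    have "G u = G ?u"
      by (rule tops_onlyD[OF to u u']) (use p q in \<open>auto simp: x_def z_def\<close>)
    also have "\<dots> = G ?v"
      by (rule balancedD[OF bal u' v' mem(1,2) i j c, symmetric])
    also have "\<dots> = G (u(i := r))"
    proof -
      \<comment> \<open>The swap moves the top of \<open>i\<close> from \<open>x\<close> to
        \<open>y\<close> and fixes the top \<open>z\<close> of \<open>j\<close>, which is neither
        \<open>x\<close> nor \<open>y\<close>.\<close>
      have "top_ranked X (?v k) = top_ranked X ((u(i := r)) k)" for k
        using top_ranked_swap_in[OF fin p(1) mem(1,2)] top_ranked_swap_in[OF fin q(1) mem(1,2)]
          p(2) q(2) ij d by (auto simp: y_def[symmetric] z_def[symmetric])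
      then show ?thesis by (rule tops_onlyD[OF to v' v])
    qed
    finally show ?thesis by simp
  qed
qed

lemma change_ordering:
  assumes fin: "finite X" and card: "card X \<ge> 3"
    and to: "tops_only X N G" and bal: "balanced X N G"
    and u: "u \<in> profiles X N" and i: "i \<in> N" and r: "r \<in> orderings X"
    and nu: "\<not> unanimous X N u" and nv: "\<not> unanimous X N (u(i := r))"
  shows "G (u(i := r)) = G u"
proof -
  have X: "X \<noteq> {}" using card by auto
  note witness = change_ordering_with_witness[OF fin to bal _ i _ _ _ _ X]
  define x y where "x = top_ranked X (u i)" and "y = top_ranked X r"
  have ui: "u i \<in> orderings X" using u i unfolding profiles_def by auto
  have mem: "x \<in> X" "y \<in> X"
    unfolding x_def y_def using top_ranked_in[OF fin X] ui r by auto
  obtain j where j: "j \<in> N" "top_ranked X (u j) \<noteq> x"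
    using nu mem unfolding unanimous_def by blast
  obtain k where k: "k \<in> N" "top_ranked X ((u(i := r)) k) \<noteq> y"
    using nv mem unfolding unanimous_def by blast
  have k': "k \<noteq> i" "top_ranked X (u k) \<noteq> y" using k y_def by (auto split: if_splits)
  show ?thesis
  proof (cases "top_ranked X (u j) = y \<and> top_ranked X (u k) = x")
    \<comment> \<open>Either \<open>j\<close> has a top other than \<open>y\<close>, or
      \<open>k\<close> has a top other than \<open>x\<close>; that individual's top then differs
      from both \<open>x\<close> and \<open>y\<close>.\<close>
    case False
    then show ?thesis using witness[OF u _ r] j k k' unfolding x_def y_def by metis
  next
    case True
    then have xy: "x \<noteq> y" using j by auto
    have "\<not> X \<subseteq> {x, y}"
    proof
      assume "X \<subseteq> {x, y}"
      then have "card X \<le> card {x, y}" by (intro card_mono) auto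
      then show False using card xy by simp
    qed
    then obtain z where z: "z \<in> X" "z \<noteq> x" "z \<noteq> y" by auto
    then have d: "distinct [z, x, y]" using xy by auto
    obtain s where s: "s \<in> orderings X" "top_ranked X s = z"
      by (rule ordering_starting_with[OF fin z(1) mem d])
    \<comment> \<open>The change from \<open>x\<close> to \<open>z\<close> has witness
      \<open>j\<close> with top \<open>y\<close>; the change from \<open>z\<close> to
      \<open>y\<close> has witness \<open>k\<close>, who still has top \<open>x\<close> because
      \<open>k\<close> is not \<open>i\<close>.\<close>
    have "G (u(i := s)) = G u"
      using witness[OF u j(1) s(1)] j True z s unfolding x_def by metis
    moreover have "G ((u(i := s))(i := r)) = G (u(i := s))"
      by (rule witness[OF profile_upd[OF u i s(1)] k(1) r])
        (use True z s k' xy in \<open>auto simp: y_def[symmetric]\<close>)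
    ultimately show ?thesis by simp
  qed
qed

text \<open>Induction on the number of individuals whose tops in \<open>u\<close> and
  \<open>v\<close> differ: giving one of them the ordering from \<open>v\<close> lowers this number
  and preserves the outcome, provided the new profile is non-unanimous.\<close>

lemma constant_on_non_unanimous_profiles:
  assumes fin: "finite X" and card: "card X \<ge> 3" and N: "card N \<ge> 3"
    and to: "tops_only X N G" and bal: "balanced X N G"
    and v: "v \<in> profiles X N" "\<not> unanimous X N v"
    and "u \<in> profiles X N" "\<not> unanimous X N u"
  shows "G u = G v"
  using assms(8,9)
proof (induction "card {i \<in> N. top_ranked X (u i) \<noteq> top_ranked X (v i)}"
    arbitrary: u rule: less_induct)
  case less
  let ?D = "\<lambda>u. {i \<in> N. top_ranked X (u i) \<noteq> top_ranked X (v i)}"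
  have finN: "finite N" using N by (metis card.infinite not_numeral_le_zero)
  have vo: "v i \<in> orderings X" if "i \<in> N" for i using v(1) that unfolding profiles_def by auto
  show ?case
  proof (cases "\<exists>i\<in>?D u. \<not> unanimous X N (u(i := v i))")
    case True
    then obtain i where i: "i \<in> N" "i \<in> ?D u" and nu: "\<not> unanimous X N (u(i := v i))" by auto
    have "?D (u(i := v i)) = ?D u - {i}" by auto
    moreover have "card (?D u - {i}) < card (?D u)"
      by (rule card_Diff1_less) (use finN i in auto)
    ultimately have "card (?D (u(i := v i))) < card (?D u)" by simp
    from less.hyps[OF this profile_upd[OF less.prems(1) i(1) vo[OF i(1)]] nu]
    show ?thesis
      using change_ordering[OF fin card to bal less.prems(1) i(1) vo[OF i(1)] less.prems(2) nu]
      by simp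
  \<comment> \<open>It remains to treat the case that every such replacement produces unanimity.
    This turns out to be possible only if no tops differ.\<close>
  next
    case False
    then have un: "\<exists>c. \<forall>l\<in>N. top_ranked X ((u(i := v i)) l) = c" if "i \<in> ?D u" for i
      using that unfolding unanimous_def by blast
    show ?thesis
    proof (cases "?D u = {}")
      case True
      then show ?thesis by (intro tops_onlyD[OF to less.prems(1) v(1)]) auto
    next
      case False
      then obtain i where i: "i \<in> ?D u" by blast
      obtain c where c: "\<And>l. l \<in> N \<Longrightarrow> top_ranked X ((u(i := v i)) l) = c"
        using un[OF i] by blast
      \<comment> \<open>If \<open>i\<close> were the only disagreement, \<open>v\<close> would have
        the tops of the unanimous profile \<open>u(i := v i)\<close>.\<close>
      have "\<exists>k\<in>?D u. k \<noteq> i"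
      proof (rule ccontr)
        assume "\<not> ?thesis"
        then have "top_ranked X (v l) = top_ranked X ((u(i := v i)) l)" if "l \<in> N" for l
          using that by auto
        then have "top_ranked X (v l) = c" if "l \<in> N" for l using c that by simp
        moreover from this have "c \<in> X"
          using i vo top_ranked_in[OF fin] card by force
        ultimately show False using v(2) unfolding unanimous_def by blast
      qed
      then obtain k where k: "k \<in> ?D u" "k \<noteq> i" by blast
      obtain d where d: "\<And>l. l \<in> N \<Longrightarrow> top_ranked X ((u(k := v k)) l) = d"
        using un[OF k(1)] by blast
      have "\<not> N \<subseteq> {i, k}"
      proof
        assume "N \<subseteq> {i, k}"
        then have "card N \<le> card {i, k}" by (intro card_mono) auto
        then show False using N k by simp
      qed
      then obtain l where l: "l \<in> N" "l \<noteq> i" "l \<noteq> k" by auto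
      \<comment> \<open>The third individual \<open>l\<close> is untouched by both replacements, so
        the two common tops agree. Then \<open>v i\<close> has top \<open>c\<close> and
        \<open>u i\<close>, unchanged when \<open>k\<close> is replaced, has top \<open>d\<close>,
        contradicting the choice of \<open>i\<close>.\<close>
      have "c = d" using c[OF l(1)] d[OF l(1)] l by simp
      then have "top_ranked X (u i) = top_ranked X (v i)"
        using c[of i] d[of i] i k(2) by simp
      then show ?thesis using i by simp
    qed
  qed
qed

theorem theorem2:
  fixes X :: "'a set" and n :: nat and G :: "(nat \<Rightarrow> 'a rel) \<Rightarrow> 'a set"
  assumes "finite X" and "card X \<ge> 3" and "n \<ge> 3"
    and "social_choice_correspondence X {1..n} G"
    and "tops_only X {1..n} G"
    and "balanced X {1..n} G"
  shows "\<exists>C. \<forall>u\<in>profiles X {1..n}. \<not> unanimous X {1..n} u \<longrightarrow> G u = C"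
proof -
  have "card {1..n} \<ge> 3" using assms(3) by simp
  note eq = constant_on_non_unanimous_profiles[OF assms(1,2) this assms(5,6)]
  show ?thesis
  \<comment> \<open>Any non-unanimous \<open>v\<close> supplies the constant \<open>G v\<close>; if
    there were none, the claim would be vacuous.\<close>
  proof (cases "\<exists>v\<in>profiles X {1..n}. \<not> unanimous X {1..n} v")
    case True
    then show ?thesis using eq by metis
  qed auto
qed

end
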